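(* Let $M=\{m_1,m_2,\ldots,m_n\}$ be a set of $n$ distinct integers, all greater than one, such that $\mathrm{lcm}(m_1,\ldots,m_n) = 2^a 3^b 5^c$ for some nonnegative integers $a,b,c$. Let $\mathcal{C}$ be a system of congruences $x \equiv r \pmod{d}$ with distinct moduli, all of whose moduli lie in $M$. Then the density of the set of integers satisfying at least one of the congruences in $\mathcal{C}$ is at most \[ \sum_{1\le i\le n} \frac{1}{m_i}\;-\sum_{\substack{1\le i<j\le n\\ \gcd(m_i,m_j)=1}}\frac{1}{m_im_j}\;+\sum_{\substack{1\le i<j<k\le n\\ \gcd(m_i,m_j)=\gcd(m_j,m_k)=\gcd(m_k,m_i)=1}}\frac{1}{m_im_jm_k}. \] In particular, if this upper bound is less than $1$, then $\mathcal{C}$ does not cover the integers, that is, some integer satisfies none of the congruences in $\mathcal{C}$.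
   Context: The set of integers satisfying at least one congruence of a finite system is periodic modulo the least common multiple $L$ of the moduli; its density is the number of such integers in $[1,L]$ divided by $L$. *)

theory Defs
  imports Complex_Main "HOL-Number_Theory.Cong"
begin

text \<open>
  A congruence \<open>x \<equiv> r (mod d)\<close> is represented by the pair \<open>(r, d)\<close> and a system of congruences by
  a set of such pairs.
\<close>

definition covered_set :: "(int \<times> int) set \<Rightarrow> int set" where
  "covered_set C = {x. \<exists>(r, d)\<in>C. [x = r] (mod d)}"

text \<open>
  The covered set of a finite system with nonzero moduli is periodic modulo the least common
  multiple \<open>L\<close> of the moduli, so its density is the proportion of covered integers in \<open>[1, L]\<close>.
  For the empty system \<open>L = 1\<close>, and the density is \<open>0\<close>.
\<close>

definition covered_density :: "(int \<times> int) set \<Rightarrow> real" where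
  "covered_density C =
     (let L = Lcm (snd ` C) in real (card (covered_set C \<inter> {1..L})) / real_of_int L)"

definition density_bound :: "nat \<Rightarrow> (nat \<Rightarrow> int) \<Rightarrow> real" where
  "density_bound n m =
     (\<Sum>i\<in>{1..n}. 1 / real_of_int (m i))
     - (\<Sum>(i, j)\<in>{(i, j). 1 \<le> i \<and> i < j \<and> j \<le> n \<and> gcd (m i) (m j) = 1}.
          1 / (real_of_int (m i) * real_of_int (m j)))
     + (\<Sum>(i, j, k)\<in>{(i, j, k). 1 \<le> i \<and> i < j \<and> j < k \<and> k \<le> n \<and>
            gcd (m i) (m j) = 1 \<and> gcd (m j) (m k) = 1 \<and> gcd (m k) (m i) = 1}.
          1 / (real_of_int (m i) * real_of_int (m j) * real_of_int (m k)))"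

lemma covered_set_periodic:
  "x + Lcm (snd ` C) \<in> covered_set C \<longleftrightarrow> x \<in> covered_set C"
proof -
  have "[x + Lcm (snd ` C) = r] (mod d) \<longleftrightarrow> [x = r] (mod d)" if "(r, d) \<in> C" for r d
  proof -
    have "d dvd Lcm (snd ` C)"
      using that by (intro dvd_Lcm) force
    then have "[x + Lcm (snd ` C) = x] (mod d)"
      by (simp add: cong_iff_dvd_diff)
    then show ?thesis
      by (meson cong_sym cong_trans)
  qed
  then show ?thesis
    unfolding covered_set_def by fast
qed

end

theory Submission
  imports Defs
begin

text \<open>
  Only the primes \<open>2\<close>, \<open>3\<close>, \<open>5\<close> divide the moduli, so two moduli are coprime exactly when their
  sets of prime factors, which are nonempty subsets of \<open>{2, 3, 5}\<close>, are disjoint. Let \<open>w A\<close> be the sum of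
  \<open>1 / m i\<close> over the moduli whose set of prime factors is \<open>A\<close>. Grouping the sums in the bound by
  these sets (lemma \<open>density_bound_eq\<close>) shows that one minus the bound equals
  \<open>(1 - w {2}) (1 - w {3}) (1 - w {5})
     - w {2, 3} (1 - w {5}) - w {2, 5} (1 - w {3}) - w {3, 5} (1 - w {2}) - w {2, 3, 5}\<close>,
  and the claim is that at least this proportion of the integers is uncovered.

  The inequality does not hold pointwise: an integer that lies in the classes modulo \<open>2\<close>, \<open>4\<close>, \<open>3\<close>
  and \<open>9\<close> and in no others contributes \<open>4 - 4 = 0\<close> to the bound. It is an inequality between
  densities. For a prime \<open>p\<close>, let \<open>u p\<close> be the density of the
  integers that avoid all congruences whose modulus is a power of \<open>p\<close>. By the Chinese remainder
  theorem these events are independent for different primes. Sieving out the remaining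
  \<open>mixed\<close> classes, each modulo some \<open>d\<close> with at least two prime factors, removes at most \<open>1 / d\<close>
  times the product of \<open>u p\<close> over the primes \<open>p\<close> that do not divide \<open>d\<close>. This yields the desired
  lower bound, except that \<open>u p\<close> stands in place of \<open>1 - w {p}\<close>. Now \<open>u p \<ge> 1 - w {p}\<close>, but the
  lower bound need not be increasing in the \<open>u p\<close>, so these cannot simply be replaced.
  Instead, the whole inequality is multiplied by the number
  \<open>\<theta> = (\<Prod>p. (1 - w {p}) / u p)\<close>. It lies in \<open>[0, 1]\<close>, because the moduli are distinct powers of
  \<open>p\<close> and hence \<open>w {p} < 1\<close> (lemma \<open>sum_prime_powers_less_1\<close>). So multiplication by \<open>\<theta>\<close> does not
  increase the uncovered density, it turns the main term into \<open>(\<Prod>p. 1 - w {p})\<close>, and it turns each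
  subtracted term into at most the required one. Lemma \<open>uncovered_density_ge\<close> carries this out for
  an arbitrary finite set of primes.
\<close>

section \<open>Densities of periodic sets\<close>

definition periodic :: "int \<Rightarrow> int set \<Rightarrow> bool" where
  "periodic N X \<longleftrightarrow> (\<forall>x y. [x = y] (mod N) \<longrightarrow> x \<in> X \<longrightarrow> y \<in> X)"

text \<open>
  This is the density of \<open>X\<close> whenever \<open>L\<close> is a positive multiple of a period of \<open>X\<close>. Fixing one window
  for all sets turns densities into a finite probability measure.
\<close>

definition dens :: "int \<Rightarrow> int set \<Rightarrow> real" where
  "dens L X = real (card (X \<inter> {0..<L})) / real_of_int L"

definition residue_class :: "int \<times> int \<Rightarrow> int set" where
  "residue_class c = {x. [x = fst c] (mod snd c)}"

lemma periodic_mod: "periodic N X \<Longrightarrow> x mod N \<in> X \<longleftrightarrow> x \<in> X"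
  unfolding periodic_def by (metis cong_mod_left cong_refl cong_sym)

lemma periodic_dvd: "periodic N X \<Longrightarrow> N dvd M \<Longrightarrow> periodic M X"
  unfolding periodic_def by (meson cong_dvd_modulus)

lemma periodic_Int: "periodic N X \<Longrightarrow> periodic N Y \<Longrightarrow> periodic N (X \<inter> Y)"
  unfolding periodic_def by blast

lemma periodic_residue_class: "periodic (snd c) (residue_class c)"
  unfolding periodic_def residue_class_def using cong_trans cong_sym by blast

lemma periodic_Compl_UN:
  assumes "\<And>c. c \<in> K \<Longrightarrow> periodic N (A c)"
  shows "periodic N (- (\<Union>c\<in>K. A c))"
proof (unfold periodic_def, intro allI impI)
  fix x y assume "[x = y] (mod N)" "x \<in> - (\<Union>c\<in>K. A c)"
  with assms show "y \<in> - (\<Union>c\<in>K. A c)"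
    using cong_sym[of x y N] unfolding periodic_def by blast
qed

lemma dens_multiple_period:
  assumes "periodic N X" "N > 0" "k > 0"
  shows "dens (N * k) X = dens N X"
proof -
  have "bij_betw (\<lambda>x. (x mod N, x div N)) (X \<inter> {0..<N * k}) ((X \<inter> {0..<N}) \<times> {0..<k})"
  proof (rule bij_betw_byWitness[where f' = "\<lambda>(r, t). r + N * t"])
    have "0 \<le> x div N \<and> x div N < k" if "0 \<le> x" "x < N * k" for x
    proof -
      have "N * (x div N) \<le> x" using assms using pos_mod_sign[of N x] mult_div_mod_eq[of N x] by linarith
      with that have "N * (x div N) < N * k" by linarith
      then show ?thesis using that assms by (simp add: pos_imp_zdiv_nonneg_iff)
    qed
    then show "(\<lambda>x. (x mod N, x div N)) ` (X \<inter> {0..<N * k}) \<subseteq> (X \<inter> {0..<N}) \<times> {0..<k}"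
      using assms by (auto simp: periodic_mod)
    have "r + N * t \<in> X \<inter> {0..<N * k}" if "r \<in> X" "r \<in> {0..<N}" "t \<in> {0..<k}" for r t
    proof -
      have "[r = r + N * t] (mod N)" by (simp add: cong_def)
      then have "r + N * t \<in> X" using assms that unfolding periodic_def by blast
      moreover have "N * (t + 1) \<le> N * k" using that assms by (intro mult_left_mono) auto
      ultimately show ?thesis using that assms by (auto simp: algebra_simps)
    qed
    then show "(\<lambda>(r, t). r + N * t) ` ((X \<inter> {0..<N}) \<times> {0..<k}) \<subseteq> X \<inter> {0..<N * k}"
      by auto
  qed (use assms in auto)
  then have "card (X \<inter> {0..<N * k}) = card (X \<inter> {0..<N}) * nat k"
    by (simp add: bij_betw_same_card card_cartesian_product)
  with assms show ?thesis
    by (simp add: dens_def)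
qed

text \<open>
  The Chinese remainder theorem as independence: a residue modulo \<open>M * N\<close> is a pair of
  residues, and membership in \<open>X\<close> and in \<open>Y\<close> depends on one component each.
\<close>

lemma dens_Int_coprime_product:
  assumes "coprime M N" "M > 0" "N > 0" "periodic M X" "periodic N Y"
  shows "dens (M * N) (X \<inter> Y) = dens M X * dens N Y"
proof -
  have "bij_betw (\<lambda>x. (x mod M, x mod N)) (X \<inter> Y \<inter> {0..<M * N})
          ((X \<inter> {0..<M}) \<times> (Y \<inter> {0..<N}))"
  proof (rule bij_betw_imageI)
    show "inj_on (\<lambda>x. (x mod M, x mod N)) (X \<inter> Y \<inter> {0..<M * N})"
    proof (rule inj_onI)
      fix x y assume xy: "x \<in> X \<inter> Y \<inter> {0..<M * N}" "y \<in> X \<inter> Y \<inter> {0..<M * N}"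
        "(x mod M, x mod N) = (y mod M, y mod N)"
      then have "[x = y] (mod M * N)"
        using assms(1) by (intro coprime_cong_mult) (auto simp: cong_def)
      then show "x = y"
        using xy by (simp add: cong_def)
    qed
    show "(\<lambda>x. (x mod M, x mod N)) ` (X \<inter> Y \<inter> {0..<M * N}) = (X \<inter> {0..<M}) \<times> (Y \<inter> {0..<N})"
    proof (intro equalityI subsetI)
      fix z assume "z \<in> (X \<inter> {0..<M}) \<times> (Y \<inter> {0..<N})"
      then obtain s t where z: "z = (s, t)" "s \<in> X" "t \<in> Y" "s \<in> {0..<M}" "t \<in> {0..<N}"
        by auto
      obtain x where x: "[x = s] (mod M)" "[x = t] (mod N)"
        using binary_chinese_remainder_int[OF assms(1)] by blast
      define y where "y = x mod (M * N)"
      have y: "[y = s] (mod M)" "[y = t] (mod N)"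
        using x unfolding y_def by (simp_all add: cong_def mod_mod_cancel)
      then have "y \<in> X" "y \<in> Y"
        using z assms(4,5) unfolding periodic_def by (meson cong_sym)+
      moreover have "y \<in> {0..<M * N}"
        using assms by (simp add: y_def)
      moreover have "z = (y mod M, y mod N)"
        using y z by (simp add: cong_def)
      ultimately show "z \<in> (\<lambda>x. (x mod M, x mod N)) ` (X \<inter> Y \<inter> {0..<M * N})"
        by blast
    qed (use assms in \<open>auto simp: periodic_mod\<close>)
  qed
  then have "card (X \<inter> Y \<inter> {0..<M * N}) = card (X \<inter> {0..<M}) * card (Y \<inter> {0..<N})"
    by (simp add: bij_betw_same_card card_cartesian_product)
  then show ?thesis
    by (simp add: dens_def)
qed

lemma dens_eq_dens_period:
  assumes "periodic N X" "N dvd L" "N > 0" "L > 0"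
  shows "dens L X = dens N X"
proof -
  obtain k where "L = N * k" using assms(2) by blast
  with assms show ?thesis
    by (simp add: dens_multiple_period zero_less_mult_iff)
qed

lemma dens_UNIV: "L > 0 \<Longrightarrow> dens L UNIV = 1"
  by (simp add: dens_def)

lemma dens_residue_class:
  assumes "snd c dvd L" "snd c > 0" "L > 0"
  shows "dens L (residue_class c) = 1 / real_of_int (snd c)"
proof -
  have "residue_class c \<inter> {0..<snd c} = {fst c mod snd c}"
    using assms by (auto simp: residue_class_def cong_def)
  then have "dens (snd c) (residue_class c) = 1 / real_of_int (snd c)"
    by (simp add: dens_def)
  with dens_eq_dens_period[OF periodic_residue_class, of c L] assms show ?thesis
    by simp
qed

lemma dens_mono: "X \<subseteq> Y \<Longrightarrow> L > 0 \<Longrightarrow> dens L X \<le> dens L Y"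
  unfolding dens_def by (intro divide_right_mono) (auto intro!: card_mono)

lemma dens_nonneg: "L > 0 \<Longrightarrow> dens L X \<ge> 0"
  by (simp add: dens_def)

text \<open>
  The union bound, with the removed sets measured only inside \<open>X\<close>. This localisation is what
  leaves the factors \<open>u p\<close> in the mixed terms later.
\<close>

lemma dens_sieve_ge:
  assumes "finite K" "L > 0"
  shows "dens L (X - (\<Union>c\<in>K. A c)) \<ge> dens L X - (\<Sum>c\<in>K. dens L (A c \<inter> X))"
proof -
  have "card (X \<inter> {0..<L}) \<le> card (((X - (\<Union>c\<in>K. A c)) \<inter> {0..<L}) \<union> (\<Union>c\<in>K. A c \<inter> X \<inter> {0..<L}))"
    using assms by (intro card_mono) auto
  also have "\<dots> \<le> card ((X - (\<Union>c\<in>K. A c)) \<inter> {0..<L}) + card (\<Union>c\<in>K. A c \<inter> X \<inter> {0..<L})"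
    by (rule card_Un_le)
  also have "card (\<Union>c\<in>K. A c \<inter> X \<inter> {0..<L}) \<le> (\<Sum>c\<in>K. card (A c \<inter> X \<inter> {0..<L}))"
    using assms by (intro card_UN_le) auto
  finally have "real (card (X \<inter> {0..<L})) \<le> real (card ((X - (\<Union>c\<in>K. A c)) \<inter> {0..<L}))
      + (\<Sum>c\<in>K. real (card (A c \<inter> X \<inter> {0..<L})))"
    by (simp flip: of_nat_sum of_nat_add)
  from divide_right_mono[OF this, of "real_of_int L"] assms show ?thesis
    by (simp add: dens_def add_divide_distrib sum_divide_distrib)
qed

lemma dens_Int_coprime:
  assumes "coprime M N" "M dvd L" "N dvd L" "M > 0" "N > 0" "L > 0" "periodic M X" "periodic N Y"
  shows "dens L (X \<inter> Y) = dens L X * dens L Y"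
proof -
  have "M * N dvd L" using assms by (simp add: divides_mult)
  moreover have "periodic (M * N) (X \<inter> Y)"
    using assms by (intro periodic_Int) (blast intro: periodic_dvd dvd_triv_left dvd_triv_right)+
  ultimately have "dens L (X \<inter> Y) = dens (M * N) (X \<inter> Y)"
    using assms by (intro dens_eq_dens_period) auto
  also have "\<dots> = dens M X * dens N Y"
    using assms by (intro dens_Int_coprime_product)
  also have "\<dots> = dens L X * dens L Y"
    using assms by (simp add: dens_eq_dens_period[of M X L] dens_eq_dens_period[of N Y L])
  finally show ?thesis .
qed

text \<open>
  Joint independence. The additional set \<open>A\<close> serves as the residue class of a mixed modulus, and it
  also makes the induction work: each step absorbs one \<open>X p\<close> into \<open>A\<close>, with period \<open>N * q p\<close>.
\<close>

lemma dens_INT_coprime: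
  assumes "finite Q" "L > 0" "N dvd L" "N > 0" "periodic N A"
    and "\<And>p. p \<in> Q \<Longrightarrow> q p > 0 \<and> q p dvd L \<and> coprime N (q p) \<and> periodic (q p) (X p)"
    and "\<And>p p'. p \<in> Q \<Longrightarrow> p' \<in> Q \<Longrightarrow> p \<noteq> p' \<Longrightarrow> coprime (q p) (q p')"
  shows "dens L (A \<inter> (\<Inter>p\<in>Q. X p)) = dens L A * (\<Prod>p\<in>Q. dens L (X p))"
  using assms
proof (induction Q arbitrary: A N rule: finite_induct)
  case (insert p Q)
  have 1: "dens L ((A \<inter> X p) \<inter> (\<Inter>p\<in>Q. X p)) = dens L (A \<inter> X p) * (\<Prod>p\<in>Q. dens L (X p))"
  proof (rule insert.IH[where N = "N * q p"])
    show "periodic (N * q p) (A \<inter> X p)"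
      using insert.prems by (intro periodic_Int) (blast intro: periodic_dvd dvd_triv_left dvd_triv_right)+
    show "q p' > 0 \<and> q p' dvd L \<and> coprime (N * q p) (q p') \<and> periodic (q p') (X p')" if "p' \<in> Q" for p'
    proof -
      have "p \<noteq> p'" using that insert.hyps by blast
      then show ?thesis using insert.prems(5,6) that by simp
    qed
  qed (use insert.prems in \<open>auto simp: divides_mult\<close>)
  have "dens L (A \<inter> X p) = dens L A * dens L (X p)"
    using insert.prems by (intro dens_Int_coprime[of N "q p"]) auto
  with 1 insert.hyps show ?case
    by (simp add: Int_assoc)
qed simp

lemma dens_Compl: "L > 0 \<Longrightarrow> dens L (- X) = 1 - dens L X"
proof -
  assume L: "L > 0"
  have "card ((- X) \<inter> {0..<L}) + card (X \<inter> {0..<L}) = card ({0..<L})"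
    by (subst card_Un_disjoint[symmetric]) (auto intro!: arg_cong[where f = card] simp del: card_atLeastLessThan_int)
  then have "real (card ((- X) \<inter> {0..<L})) + real (card (X \<inter> {0..<L})) = real_of_int L"
    using L by (simp flip: of_nat_add)
  then show ?thesis
    using L by (simp add: dens_def field_simps)
qed

lemma covered_set_eq_UN: "covered_set C = (\<Union>c\<in>C. residue_class c)"
  by (auto simp: covered_set_def residue_class_def case_prod_unfold)

lemma Lcm_moduli_pos:
  assumes "finite C" "\<And>c. c \<in> C \<Longrightarrow> snd c > (0::int)"
  shows "Lcm (snd ` C) > 0"
proof -
  have "0 \<notin> snd ` C" using assms(2) by force
  then have "Lcm (snd ` C) \<noteq> 0" using assms(1) by (simp add: Lcm_0_iff)
  moreover have "Lcm (snd ` C) \<ge> 0" by simp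
  ultimately show ?thesis by linarith
qed

text \<open>
  By periodicity the windows \<open>{1..L}\<close> and \<open>{0..<L}\<close> contain equally many covered integers, as they
  differ only in their endpoints \<open>L\<close> and \<open>0\<close>.
\<close>

lemma covered_density_eq_dens:
  assumes "finite C" "\<And>c. c \<in> C \<Longrightarrow> snd c > 0"
  shows "covered_density C = dens (Lcm (snd ` C)) (covered_set C)"
proof -
  define L where "L = Lcm (snd ` C)"
  have L: "L > 0" using Lcm_moduli_pos[OF assms] by (simp add: L_def)
  define X where "X = covered_set C"
  have "L \<in> X \<longleftrightarrow> 0 \<in> X"
    using covered_set_periodic[of 0 C] by (simp add: X_def L_def)
  moreover have "{1..L} = insert L {1..<L}" "{0..<L} = insert 0 {1..<L}"
    using L by auto
  ultimately have "card (X \<inter> {1..L}) = card (X \<inter> {0..<L})"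
    by (cases "0 \<in> X") auto
  then show ?thesis
    by (simp add: covered_density_def dens_def X_def L_def Let_def)
qed

section \<open>The uncovered density for a finite set of primes\<close>

lemma prime_power_modulus:
  fixes d :: int
  assumes "d > 0" "prime_factors d = {p}"
  shows "d = p ^ multiplicity p d"
  using prod_prime_factors[of d] assms by simp

lemma coprime_prime_power:
  fixes d :: int
  assumes "d \<noteq> 0" "prime p" "p \<notin> prime_factors d"
  shows "coprime d (p ^ e)"
proof -
  have "\<not> p dvd d" using assms by (simp add: prime_factors_dvd)
  then show ?thesis using assms(2)
    by (metis coprime_commute coprime_power_right_iff prime_imp_coprime)
qed

text \<open>
  The number \<open>a p\<close> may be any upper bound below \<open>1\<close> for the sum of the densities of the classes modulo
  powers of \<open>p\<close>. This freedom allows the bound to be taken over a larger family of moduli than those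
  of the system itself.
\<close>

lemma uncovered_density_ge:
  fixes C :: "(int \<times> int) set" and P :: "int set" and a :: "int \<Rightarrow> real"
  assumes C: "finite C" and P: "finite P" "\<And>p. p \<in> P \<Longrightarrow> prime p"
    and moduli: "\<And>c. c \<in> C \<Longrightarrow> snd c > 1" "\<And>c. c \<in> C \<Longrightarrow> prime_factors (snd c) \<subseteq> P"
    and a: "\<And>p. p \<in> P \<Longrightarrow> a p < 1"
      "\<And>p. p \<in> P \<Longrightarrow> (\<Sum>c | c \<in> C \<and> prime_factors (snd c) = {p}. 1 / real_of_int (snd c)) \<le> a p"
  shows "(\<Prod>p\<in>P. 1 - a p)
      - (\<Sum>c | c \<in> C \<and> card (prime_factors (snd c)) \<ge> 2.
           1 / real_of_int (snd c) * (\<Prod>p\<in>P - prime_factors (snd c). 1 - a p))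
    \<le> 1 - covered_density C"
proof -
  define L where "L = Lcm (snd ` C)"
  have pos: "snd c > 0" if "c \<in> C" for c
    using moduli(1)[OF that] by simp
  have L: "L > 0"
    unfolding L_def by (rule Lcm_moduli_pos[OF C pos])
  have dvd_L: "snd c dvd L" if "c \<in> C" for c
    using that by (simp add: L_def dvd_Lcm)
  define pf where "pf c = prime_factors (snd c)" for c :: "int \<times> int"
  define pure where "pure p = {c \<in> C. pf c = {p}}" for p
  define mixed where "mixed = {c \<in> C. card (pf c) \<ge> 2}"
  define U where "U p = - (\<Union>c\<in>pure p. residue_class c)" for p
  define u where "u p = dens L (U p)" for p
  define b where "b p = 1 - a p" for p
  define q where "q p = p ^ multiplicity p L" for p
  have fin: "finite (pure p)" "finite mixed" for p
    using C by (simp_all add: pure_def mixed_def)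
  have dens_class: "dens L (residue_class c) = 1 / real_of_int (snd c)" if "c \<in> C" for c
    using that pos dvd_L L by (simp add: dens_residue_class)

  have b_pos: "b p > 0" if "p \<in> P" for p
    using a(1)[OF that] by (simp add: b_def)
  have b_le_u: "b p \<le> u p" if "p \<in> P" for p
  proof -
    have "1 - (\<Sum>c\<in>pure p. dens L (residue_class c)) \<le> u p"
      using dens_sieve_ge[OF fin(1) L, of UNIV residue_class p] L
      by (simp add: u_def U_def Compl_eq_Diff_UNIV dens_UNIV)
    moreover have "(\<Sum>c\<in>pure p. dens L (residue_class c)) \<le> a p"
    proof -
      have "(\<Sum>c\<in>pure p. dens L (residue_class c)) = (\<Sum>c\<in>pure p. 1 / real_of_int (snd c))"
        by (intro sum.cong) (auto simp: pure_def dens_class)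
      also have "\<dots> \<le> a p"
        using a(2)[OF that] by (simp add: pure_def pf_def)
      finally show ?thesis .
    qed
    ultimately show ?thesis by (simp add: b_def)
  qed
  have u_pos: "u p > 0" if "p \<in> P" for p
    using b_pos[OF that] b_le_u[OF that] by linarith

  \<comment> \<open>The part of \<open>L\<close> at \<open>p\<close> is a common period of all classes modulo powers of \<open>p\<close>.\<close>
  have q: "q p > 0 \<and> q p dvd L \<and> periodic (q p) (U p)" if p: "p \<in> P" for p
  proof (intro conjI)
    show "q p > 0" using P(2)[OF p] by (simp add: q_def prime_gt_0_int)
    show "q p dvd L" by (simp add: q_def multiplicity_dvd)
    show "periodic (q p) (U p)"
      unfolding U_def
    proof (rule periodic_Compl_UN)
      fix c assume "c \<in> pure p"
      then have c: "c \<in> C" "prime_factors (snd c) = {p}"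
        by (auto simp: pure_def pf_def)
      have "multiplicity p (snd c) \<le> multiplicity p L"
        using dvd_L[OF c(1)] L by (intro dvd_imp_multiplicity_le) auto
      then have "p ^ multiplicity p (snd c) dvd q p"
        by (simp add: q_def le_imp_power_dvd)
      then have "snd c dvd q p"
        using prime_power_modulus[OF pos c(2)] c(1) by simp
      then show "periodic (q p) (residue_class c)"
        by (rule periodic_dvd[OF periodic_residue_class])
    qed
  qed
  have q_coprime: "coprime (q p) (q p')" if "p \<in> P" "p' \<in> P" "p \<noteq> p'" for p p'
    using P(2)[OF that(1)] P(2)[OF that(2)] that(3) by (simp add: q_def primes_coprime)

  have dens_U: "dens L (\<Inter>p\<in>P. U p) = (\<Prod>p\<in>P. u p)"
    using dens_INT_coprime[OF P(1) L, of 1 UNIV q U] q q_coprime L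
    by (simp add: u_def periodic_def dens_UNIV)
  \<comment> \<open>The primes dividing the modulus of \<open>c\<close> are dropped, as independence can fail for them.\<close>
  have dens_mixed: "dens L (residue_class c \<inter> (\<Inter>p\<in>P. U p))
      \<le> 1 / real_of_int (snd c) * (\<Prod>p\<in>P - pf c. u p)" if "c \<in> mixed" for c
  proof -
    have c: "c \<in> C" using that by (simp add: mixed_def)
    have "dens L (residue_class c \<inter> (\<Inter>p\<in>P. U p))
        \<le> dens L (residue_class c \<inter> (\<Inter>p\<in>P - pf c. U p))"
      using L by (intro dens_mono) auto
    also have "\<dots> = dens L (residue_class c) * (\<Prod>p\<in>P - pf c. u p)"
      unfolding u_def
    proof (rule dens_INT_coprime[where N = "snd c" and q = q])
      fix p assume p: "p \<in> P - pf c"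
      then have "coprime (snd c) (q p)"
        using pos[OF c] P(2) unfolding q_def pf_def by (intro coprime_prime_power) auto
      with q p show "q p > 0 \<and> q p dvd L \<and> coprime (snd c) (q p) \<and> periodic (q p) (U p)"
        by blast
    qed (use P(1) L dvd_L pos c q_coprime periodic_residue_class in auto)
    finally show ?thesis using dens_class[OF c] by simp
  qed

  \<comment> \<open>A modulus greater than one is either a power of a single prime or has at least two prime factors.\<close>
  have C_split: "C = (\<Union>p\<in>P. pure p) \<union> mixed"
  proof (intro equalityI subsetI)
    fix c assume c: "c \<in> C"
    have "pf c \<noteq> {}"
      using moduli(1)[OF c] by (auto simp: pf_def prime_factorization_empty_iff)
    then have "card (pf c) \<noteq> 0" by (simp add: pf_def)
    then consider "card (pf c) = 1" | "card (pf c) \<ge> 2" by linarith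
    then show "c \<in> (\<Union>p\<in>P. pure p) \<union> mixed"
    proof cases
      case 1
      then obtain p where "pf c = {p}" by (auto simp: card_1_singleton_iff)
      with c moduli(2)[OF c] show ?thesis by (auto simp: pure_def pf_def)
    qed (use c in \<open>simp add: mixed_def\<close>)
  qed (auto simp: pure_def mixed_def)
  have "- covered_set C = (\<Inter>p\<in>P. U p) - (\<Union>c\<in>mixed. residue_class c)"
    unfolding covered_set_eq_UN by (subst C_split) (auto simp: U_def)
  moreover have "1 - covered_density C = dens L (- covered_set C)"
    using covered_density_eq_dens[OF C pos] dens_Compl[OF L] by (simp add: L_def)
  ultimately have "1 - covered_density C = dens L ((\<Inter>p\<in>P. U p) - (\<Union>c\<in>mixed. residue_class c))"
    by simp
  also have "\<dots> \<ge> dens L (\<Inter>p\<in>P. U p) - (\<Sum>c\<in>mixed. dens L (residue_class c \<inter> (\<Inter>p\<in>P. U p)))"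
    by (rule dens_sieve_ge[OF fin(2) L])
  finally have "dens L (\<Inter>p\<in>P. U p) - (\<Sum>c\<in>mixed. dens L (residue_class c \<inter> (\<Inter>p\<in>P. U p)))
      \<le> 1 - covered_density C" .
  moreover have "(\<Sum>c\<in>mixed. dens L (residue_class c \<inter> (\<Inter>p\<in>P. U p)))
      \<le> (\<Sum>c\<in>mixed. 1 / real_of_int (snd c) * (\<Prod>p\<in>P - pf c. u p))"
    by (intro sum_mono dens_mixed)
  ultimately have sieve: "(\<Prod>p\<in>P. u p) - (\<Sum>c\<in>mixed. 1 / real_of_int (snd c) * (\<Prod>p\<in>P - pf c. u p))
      \<le> 1 - covered_density C"
    unfolding dens_U by linarith

  \<comment> \<open>Scaling by \<open>\<theta> P\<close> replaces every \<open>u p\<close> by \<open>b p\<close>. In a mixed term the factors of \<open>\<theta> P\<close> at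
    primes dividing the modulus are left over, and they are at most \<open>1\<close>.\<close>
  define \<theta> where "\<theta> Q = (\<Prod>p\<in>Q. b p / u p)" for Q
  have \<theta>: "0 \<le> \<theta> Q" "\<theta> Q \<le> 1" if "Q \<subseteq> P" for Q
    unfolding \<theta>_def using that b_pos b_le_u u_pos
    by (auto intro!: prod_nonneg prod_le_1 simp: divide_le_eq_1 less_imp_le subset_iff)
  have \<theta>_prod: "\<theta> Q * (\<Prod>p\<in>Q. u p) = (\<Prod>p\<in>Q. b p)" if "Q \<subseteq> P" for Q
    using that u_pos unfolding \<theta>_def prod.distrib[symmetric]
    by (intro prod.cong) (force simp: subset_iff)+
  have \<theta>_partial: "\<theta> P * (\<Prod>p\<in>P - pf c. u p) \<le> (\<Prod>p\<in>P - pf c. b p)" for c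
  proof -
    have "\<theta> P = \<theta> (P - pf c) * \<theta> (P \<inter> pf c)"
      unfolding \<theta>_def using P(1) by (subst prod.union_disjoint[symmetric]) (auto intro: prod.cong)
    then have "\<theta> P * (\<Prod>p\<in>P - pf c. u p) = (\<Prod>p\<in>P - pf c. b p) * \<theta> (P \<inter> pf c)"
      using \<theta>_prod[of "P - pf c"] by (simp add: mult_ac)
    also have "\<dots> \<le> (\<Prod>p\<in>P - pf c. b p) * 1"
      using \<theta>(2)[of "P \<inter> pf c"] b_pos
      by (intro mult_left_mono prod_nonneg) (auto simp: less_imp_le)
    finally show ?thesis by simp
  qed
  have "(\<Prod>p\<in>P. b p) - (\<Sum>c\<in>mixed. 1 / real_of_int (snd c) * (\<Prod>p\<in>P - pf c. b p))
      \<le> \<theta> P * (\<Prod>p\<in>P. u p) - (\<Sum>c\<in>mixed. 1 / real_of_int (snd c) * (\<theta> P * (\<Prod>p\<in>P - pf c. u p)))"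
  proof (intro diff_mono sum_mono mult_left_mono \<theta>_partial)
    show "0 \<le> 1 / real_of_int (snd c)" if "c \<in> mixed" for c
      using pos[of c] that by (simp add: mixed_def)
  qed (simp add: \<theta>_prod)
  also have "\<dots> = \<theta> P * ((\<Prod>p\<in>P. u p) - (\<Sum>c\<in>mixed. 1 / real_of_int (snd c) * (\<Prod>p\<in>P - pf c. u p)))"
    by (simp add: right_diff_distrib sum_distrib_left mult_ac)
  also have "\<dots> \<le> \<theta> P * (1 - covered_density C)"
    using \<theta>(1)[of P] sieve by (intro mult_left_mono) auto
  also have "\<dots> \<le> 1 * (1 - covered_density C)"
  proof (rule mult_right_mono)
    show "0 \<le> 1 - covered_density C"
      using covered_density_eq_dens[OF C pos] dens_Compl[OF L, of "covered_set C"]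
        dens_nonneg[OF L, of "- covered_set C"] by (simp add: L_def)
  qed (use \<theta>(2) in auto)
  finally show ?thesis
    by (simp add: b_def mixed_def pf_def)
qed

text \<open>
  The elements of \<open>T\<close> are distinct powers of \<open>p\<close> with positive exponents, so the sum is at
  most a partial sum of \<open>1/2 + 1/4 + 1/8 + \<dots>\<close>.
\<close>

lemma sum_prime_powers_less_1:
  fixes T :: "int set"
  assumes "finite T" "prime p" "\<And>d. d \<in> T \<Longrightarrow> d > 0 \<and> prime_factors d = {p}"
  shows "(\<Sum>d\<in>T. 1 / real_of_int d) < 1"
proof -
  have p: "p \<ge> 2" using assms(2) by (simp add: prime_ge_2_int)
  have T: "d = p ^ multiplicity p d" "multiplicity p d > 0" if "d \<in> T" for d
  proof -
    show "d = p ^ multiplicity p d" using prime_power_modulus assms(3)[OF that] by blast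
    have "p \<in> prime_factors d" using assms(3)[OF that] by simp
    then show "multiplicity p d > 0" by (simp add: prime_factors_multiplicity)
  qed
  define K where "K = multiplicity p ` T"
  obtain N where N: "K \<subseteq> {1..N}"
  proof -
    have "finite K" using assms(1) by (simp add: K_def)
    then obtain N where "\<forall>k\<in>K. k \<le> N" using finite_nat_set_iff_bounded_le by auto
    moreover have "\<forall>k\<in>K. 1 \<le> k" using T(2) by (auto simp: K_def Suc_le_eq)
    ultimately have "K \<subseteq> {1..N}" by auto
    then show ?thesis by (rule that)
  qed
  have "(\<Sum>d\<in>T. 1 / real_of_int d) = (\<Sum>d\<in>T. 1 / real_of_int p ^ multiplicity p d)"
    using T(1) by (intro sum.cong refl) (metis of_int_power)
  also have "\<dots> = (\<Sum>k\<in>K. 1 / real_of_int p ^ k)"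
    unfolding K_def using T(1) by (subst sum.reindex) (auto intro!: inj_onI, metis)
  also have "\<dots> \<le> (\<Sum>k\<in>K. 1 / 2 ^ k)"
    using p by (intro sum_mono divide_left_mono power_mono) auto
  also have "\<dots> \<le> (\<Sum>k\<in>{1..N}. 1 / 2 ^ k)"
    using N by (intro sum_mono2) auto
  also have "\<dots> = 1 - 1 / 2 ^ N"
    by (induction N) (auto simp: field_simps)
  finally show ?thesis
    by (smt (verit) zero_less_divide_1_iff zero_less_power)
qed

section \<open>The bound in terms of sets of prime factors\<close>

lemma coprime_iff_prime_factors_disjoint:
  fixes x y :: int
  assumes "x \<noteq> 0" "y \<noteq> 0"
  shows "coprime x y \<longleftrightarrow> prime_factors x \<inter> prime_factors y = {}"
proof -
  have "prime_factors x \<inter> prime_factors y = prime_factors (gcd x y)"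
    using assms by (rule prime_factors_gcd[symmetric])
  also have "\<dots> = {} \<longleftrightarrow> gcd x y = 1"
    using assms by (simp add: prime_factorization_empty_iff del: prime_factors_gcd)
  finally show ?thesis by (simp add: coprime_iff_gcd_eq_1)
qed

lemma sum_ordered_pairs:
  fixes g :: "nat \<Rightarrow> nat \<Rightarrow> real"
  assumes sym: "\<And>i j. g i j = g j i" and diag: "\<And>i. i \<in> I \<Longrightarrow> g i i = 0"
  shows "(\<Sum>i\<in>I. \<Sum>j\<in>I. g i j) = 2 * (\<Sum>i\<in>I. \<Sum>j\<in>I. if i < j then g i j else 0)"
proof -
  define h where "h i j = (if i < j then g i j else 0)" for i j
  have "(\<Sum>i\<in>I. \<Sum>j\<in>I. g i j) = (\<Sum>i\<in>I. \<Sum>j\<in>I. h i j + h j i)"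
    using sym diag by (intro sum.cong refl) (auto simp: h_def not_less_iff_gr_or_eq)
  also have "\<dots> = (\<Sum>i\<in>I. \<Sum>j\<in>I. h i j) + (\<Sum>i\<in>I. \<Sum>j\<in>I. h j i)"
    by (simp add: sum.distrib)
  also have "(\<Sum>i\<in>I. \<Sum>j\<in>I. h j i) = (\<Sum>i\<in>I. \<Sum>j\<in>I. h i j)"
    by (rule sum.swap)
  finally show ?thesis by (simp add: h_def)
qed

text \<open>
  A triple of distinct indices has exactly one increasing rearrangement. So \<open>g\<close> is the sum of the
  six permutations of its restriction \<open>h\<close> to increasing triples, and all six have the same total.
\<close>

lemma sum_ordered_triples:
  fixes g :: "nat \<Rightarrow> nat \<Rightarrow> nat \<Rightarrow> real"
  assumes sym: "\<And>i j k. g i j k = g j i k" "\<And>i j k. g i j k = g i k j"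
    and diag: "\<And>i k. i \<in> I \<Longrightarrow> g i i k = 0"
  shows "(\<Sum>i\<in>I. \<Sum>j\<in>I. \<Sum>k\<in>I. g i j k)
    = 6 * (\<Sum>i\<in>I. \<Sum>j\<in>I. \<Sum>k\<in>I. if i < j \<and> j < k then g i j k else 0)"
proof -
  define h where "h i j k = (if i < j \<and> j < k then g i j k else 0)" for i j k
  have split: "g i j k = h i j k + h i k j + h j i k + h j k i + h k i j + h k j i"
    if "i \<in> I" "j \<in> I" "k \<in> I" for i j k
  proof -
    have "g i i k = 0" "g j j i = 0" "g k k i = 0" "g i i j = 0" using diag that by auto
    then have deg: "g i j k = 0" if "i = j \<or> j = k \<or> i = k"
      using that sym by metis
    have perms: "g i k j = g i j k" "g j i k = g i j k" "g j k i = g i j k"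
      "g k i j = g i j k" "g k j i = g i j k"
      using sym by metis+
    show ?thesis
    proof (cases "i = j \<or> j = k \<or> i = k")
      case True
      then show ?thesis using deg by (auto simp: h_def)
    next
      case False
      then show ?thesis unfolding h_def perms
        by (cases "i < j"; cases "j < k"; cases "i < k") simp_all
    qed
  qed
  let ?S = "\<lambda>f. \<Sum>i\<in>I. \<Sum>j\<in>I. \<Sum>k\<in>I. f i j k :: real"
  have swap1: "?S (\<lambda>i j k. f j i k) = ?S f" for f by (rule sum.swap)
  have swap2: "?S (\<lambda>i j k. f i k j) = ?S f" for f by (intro sum.cong refl sum.swap)
  have "?S g = ?S (\<lambda>i j k. h i j k + h i k j + h j i k + h j k i + h k i j + h k j i)"
    by (intro sum.cong refl split)
  also have "\<dots> = ?S h + ?S (\<lambda>i j k. h i k j) + ?S (\<lambda>i j k. h j i k)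
      + ?S (\<lambda>i j k. h j k i) + ?S (\<lambda>i j k. h k i j) + ?S (\<lambda>i j k. h k j i)"
    by (simp add: sum.distrib)
  also have "?S (\<lambda>i j k. h i k j) = ?S h" by (rule swap2)
  also have "?S (\<lambda>i j k. h j i k) = ?S h" by (rule swap1)
  also have "?S (\<lambda>i j k. h j k i) = ?S h"
    using swap1[of "\<lambda>i j k. h i k j"] swap2[of h] by simp
  also have "?S (\<lambda>i j k. h k i j) = ?S h"
    using swap2[of "\<lambda>i j k. h j i k"] swap1[of h] by simp
  also have "?S (\<lambda>i j k. h k j i) = ?S h"
    using swap2[of "\<lambda>i j k. h j k i"] swap1[of "\<lambda>i j k. h i k j"] swap2[of h] by simp
  finally show ?thesis by (simp add: h_def)
qed

lemma sum_Pow_insert: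
  fixes h :: "'a set \<Rightarrow> real"
  assumes "finite A" "x \<notin> A"
  shows "sum h (Pow (insert x A)) = sum h (Pow A) + (\<Sum>B\<in>Pow A. h (insert x B))"
proof -
  have "inj_on (insert x) (Pow A)"
    using assms(2) by (auto simp: inj_on_def)
  moreover have "Pow A \<inter> insert x ` Pow A = {}" using assms(2) by auto
  ultimately show ?thesis
    using assms(1) by (simp add: Pow_insert sum.union_disjoint sum.reindex)
qed

lemma sum_Pow_2_3_5:
  fixes h :: "int set \<Rightarrow> real"
  shows "(\<Sum>A\<in>Pow {2, 3, 5}. h A) = h {} + h {2} + h {3} + h {5} + h {2, 3} + h {2, 5} + h {3, 5} + h {2, 3, 5}"
  by (simp add: sum_Pow_insert)

text \<open>
  This turns a sum over indices into a sum over the sets of prime factors. Applied once per index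
  in nested sums, it reduces the pair and triple sums to polynomials in the weights.
\<close>

lemma sum_group_weights:
  fixes f :: "'i \<Rightarrow> real"
  assumes "finite I" "finite T" "\<And>i. i \<in> I \<Longrightarrow> s i \<in> T"
  shows "(\<Sum>i\<in>I. f i * h (s i)) = (\<Sum>A\<in>T. (\<Sum>i | i \<in> I \<and> s i = A. f i) * h A)"
proof -
  have "(\<Sum>i\<in>I. f i * h (s i)) = (\<Sum>A\<in>T. \<Sum>i | i \<in> I \<and> s i = A. f i * h (s i))"
    using assms by (subst sum.group) auto
  also have "\<dots> = (\<Sum>A\<in>T. (\<Sum>i | i \<in> I \<and> s i = A. f i) * h A)"
    unfolding sum_distrib_right by (intro sum.cong) auto
  finally show ?thesis .
qed

text \<open>
  Coprime pairs come from disjoint sets of prime factors: two different singletons, or a singleton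
  and its complement in \<open>{2, 3, 5}\<close>. Pairwise coprime triples come only from the three singletons.
\<close>

lemma density_bound_eq:
  fixes m :: "nat \<Rightarrow> int" and w :: "int set \<Rightarrow> real"
  assumes m: "\<And>i. i \<in> {1..n} \<Longrightarrow> m i > 1"
    and smooth: "\<And>i. i \<in> {1..n} \<Longrightarrow> prime_factors (m i) \<subseteq> {2, 3, 5}"
  defines "w \<equiv> \<lambda>A. \<Sum>i | i \<in> {1..n} \<and> prime_factors (m i) = A. 1 / real_of_int (m i)"
  shows "1 - density_bound n m = (1 - w {2}) * (1 - w {3}) * (1 - w {5})
    - (w {2, 3} * (1 - w {5}) + w {2, 5} * (1 - w {3}) + w {3, 5} * (1 - w {2}) + w {2, 3, 5})"
proof -
  define I where "I = {1..n}"
  define f where "f i = 1 / real_of_int (m i)" for i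
  define s where "s i = prime_factors (m i)" for i
  have nonempty: "s i \<noteq> {}" if "i \<in> I" for i
    using m that by (force simp: s_def I_def prime_factorization_empty_iff)
  have "{i. i \<in> {1..n} \<and> prime_factors (m i) = {}} = {}"
    using nonempty by (auto simp: I_def s_def)
  then have w_empty: "w {} = 0"
    by (simp only: w_def sum.empty)
  have group: "(\<Sum>i\<in>I. f i * h (s i)) = (\<Sum>A\<in>Pow {2, 3, 5}. w A * h A)" for h
    unfolding w_def f_def s_def I_def
    by (rule sum_group_weights) (use smooth in auto)
  have coprime_iff: "coprime (m i) (m j) \<longleftrightarrow> s i \<inter> s j = {}" if "i \<in> I" "j \<in> I" for i j
    unfolding s_def using that m
    by (intro coprime_iff_prime_factors_disjoint) (force simp: I_def)+

  define g2 where "g2 i j = (if s i \<inter> s j = {} then f i * f j else 0)" for i j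
  define g3 where "g3 i j k = (if s i \<inter> s j = {} \<and> s j \<inter> s k = {} \<and> s k \<inter> s i = {}
    then f i * f j * f k else 0)" for i j k

  define S1 where "S1 = (\<Sum>i\<in>I. f i)"
  define S2 where "S2 = (\<Sum>(i, j)\<in>{(i, j). 1 \<le> i \<and> i < j \<and> j \<le> n \<and> gcd (m i) (m j) = 1}.
    1 / (real_of_int (m i) * real_of_int (m j)))"
  define S3 where "S3 = (\<Sum>(i, j, k)\<in>{(i, j, k). 1 \<le> i \<and> i < j \<and> j < k \<and> k \<le> n \<and>
            gcd (m i) (m j) = 1 \<and> gcd (m j) (m k) = 1 \<and> gcd (m k) (m i) = 1}.
          1 / (real_of_int (m i) * real_of_int (m j) * real_of_int (m k)))"
  have bound: "density_bound n m = S1 - S2 + S3"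
    by (simp add: density_bound_def S1_def S2_def S3_def I_def f_def)

  have S1: "S1 = (\<Sum>A\<in>Pow {2, 3, 5}. w A * 1)"
    using group[of "\<lambda>_. 1"] by (simp add: S1_def)

  have "S2 = (\<Sum>(i, j)\<in>I \<times> I. if i < j then g2 i j else 0)"
    unfolding S2_def
    by (rule sum.mono_neutral_cong_left)
      (auto simp: I_def f_def g2_def coprime_iff[unfolded I_def] split: if_splits)
  also have "\<dots> = (\<Sum>i\<in>I. \<Sum>j\<in>I. if i < j then g2 i j else 0)"
    by (simp add: sum.cartesian_product)
  finally have "2 * S2 = (\<Sum>i\<in>I. \<Sum>j\<in>I. g2 i j)"
  proof (subst sum_ordered_pairs)
    show "g2 i j = g2 j i" for i j
      by (auto simp: g2_def)
    show "g2 i i = 0" if "i \<in> I" for i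
      using nonempty[OF that] by (simp add: g2_def)
  qed simp
  also have "\<dots> = (\<Sum>i\<in>I. f i * (\<Sum>j\<in>I. f j * of_bool (s i \<inter> s j = {})))"
    unfolding sum_distrib_left by (intro sum.cong) (auto simp: g2_def)
  also have "\<dots> = (\<Sum>A\<in>Pow {2, 3, 5}. w A * (\<Sum>B\<in>Pow {2, 3, 5}. w B * of_bool (A \<inter> B = {})))"
    unfolding group[of "\<lambda>B. of_bool (s _ \<inter> B = {})"]
    by (rule group[of "\<lambda>A. \<Sum>B\<in>Pow {2, 3, 5}. w B * of_bool (A \<inter> B = {})"])
  finally have S2: "2 * S2 = \<dots>" .

  have "S3 = (\<Sum>(i, j, k)\<in>I \<times> I \<times> I. if i < j \<and> j < k then g3 i j k else 0)"
    unfolding S3_def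
    by (rule sum.mono_neutral_cong_left)
      (auto simp: I_def f_def g3_def coprime_iff[unfolded I_def] split: if_splits)
  also have "\<dots> = (\<Sum>i\<in>I. \<Sum>j\<in>I. \<Sum>k\<in>I. if i < j \<and> j < k then g3 i j k else 0)"
    by (simp add: sum.cartesian_product)
  finally have "6 * S3 = (\<Sum>i\<in>I. \<Sum>j\<in>I. \<Sum>k\<in>I. g3 i j k)"
  proof (subst sum_ordered_triples)
    show "g3 i j k = g3 j i k" "g3 i j k = g3 i k j" for i j k
      by (auto simp: g3_def)
    show "g3 i i k = 0" if "i \<in> I" for i k
      using nonempty[OF that] by (simp add: g3_def)
  qed simp
  also have "\<dots> = (\<Sum>i\<in>I. f i * (\<Sum>j\<in>I. f j * (of_bool (s i \<inter> s j = {})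
      * (\<Sum>k\<in>I. f k * of_bool (s i \<inter> s k = {} \<and> s j \<inter> s k = {})))))"
    unfolding sum_distrib_left by (intro sum.cong) (auto simp: g3_def)
  also have "\<dots> = (\<Sum>A\<in>Pow {2, 3, 5}. w A * (\<Sum>B\<in>Pow {2, 3, 5}. w B * (of_bool (A \<inter> B = {})
      * (\<Sum>D\<in>Pow {2, 3, 5}. w D * of_bool (A \<inter> D = {} \<and> B \<inter> D = {})))))"
    unfolding group[of "\<lambda>D. of_bool (s _ \<inter> D = {} \<and> s _ \<inter> D = {})"]
      group[of "\<lambda>B. of_bool (s _ \<inter> B = {})
      * (\<Sum>D\<in>Pow {2, 3, 5}. w D * of_bool (s _ \<inter> D = {} \<and> B \<inter> D = {}))"]
    by (rule group)
  finally have S3: "6 * S3 = \<dots>" .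

  note expand = sum_Pow_2_3_5 w_empty
  have 1: "S1 = w {2} + w {3} + w {5} + w {2, 3} + w {2, 5} + w {3, 5} + w {2, 3, 5}"
    using S1 by (simp add: expand)
  have 2: "S2 = w {2} * w {3} + w {2} * w {5} + w {3} * w {5}
      + w {2} * w {3, 5} + w {3} * w {2, 5} + w {5} * w {2, 3}"
    using S2 by (simp add: expand algebra_simps)
  have 3: "S3 = w {2} * w {3} * w {5}"
    using S3 by (simp add: expand algebra_simps)
  show ?thesis
    unfolding bound 1 2 3 by (simp add: algebra_simps)
qed

section \<open>Systems with moduli dividing a product of powers of 2, 3 and 5\<close>

text \<open>
  The system may use only some of the moduli in \<open>m ` I\<close>. As its moduli are distinct, each index is
  used at most once.
\<close>

lemma sum_subsystem_le:
  fixes m :: "'i \<Rightarrow> 'd" and g :: "'d \<Rightarrow> real"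
  assumes "finite I" "inj_on m I" "inj_on snd C" "snd ` C \<subseteq> m ` I"
    and "\<And>i. i \<in> I \<Longrightarrow> Q (m i) \<Longrightarrow> g (m i) \<ge> 0"
  shows "(\<Sum>c | c \<in> C \<and> Q (snd c). g (snd c)) \<le> (\<Sum>i | i \<in> I \<and> Q (m i). g (m i))"
proof -
  have "(\<Sum>c | c \<in> C \<and> Q (snd c). g (snd c)) = sum g (snd ` {c \<in> C. Q (snd c)})"
    using assms(3) by (subst sum.reindex) (auto intro: inj_on_subset)
  also have "\<dots> \<le> sum g (m ` {i \<in> I. Q (m i)})"
    using assms by (intro sum_mono2) auto
  also have "\<dots> = (\<Sum>i | i \<in> I \<and> Q (m i). g (m i))"
    using assms(2) by (subst sum.reindex) (auto intro: inj_on_subset)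
  finally show ?thesis .
qed

theorem theorem1p9:
  fixes n a b c :: nat and m :: "nat \<Rightarrow> int" and C :: "(int \<times> int) set"
  assumes "inj_on m {1..n}"
    and "\<And>i. i \<in> {1..n} \<Longrightarrow> m i > 1"
    and "Lcm (m ` {1..n}) = 2 ^ a * 3 ^ b * 5 ^ c"
    and "inj_on snd C"
    and "snd ` C \<subseteq> m ` {1..n}"
  shows "covered_density C \<le> density_bound n m
    \<and> (density_bound n m < 1 \<longrightarrow> (\<exists>x::int. \<forall>(r, d)\<in>C. \<not> [x = r] (mod d)))"
proof -
  define P :: "int set" where "P = {2, 3, 5}"
  define w where "w A = (\<Sum>i | i \<in> {1..n} \<and> prime_factors (m i) = A. 1 / real_of_int (m i))" for A
  have smooth: "prime_factors (m i) \<subseteq> P" if "i \<in> {1..n}" for i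
  proof
    fix p assume p: "p \<in> prime_factors (m i)"
    then have "prime p" "p dvd m i" by auto
    moreover have "m i dvd Lcm (m ` {1..n})" using that by (intro dvd_Lcm) auto
    ultimately have "p dvd 2 ^ a * 3 ^ b * 5 ^ c"
      using assms(3) dvd_trans by metis
    then have "p dvd 2 \<or> p dvd 3 \<or> p dvd 5"
      using \<open>prime p\<close> by (auto simp: prime_dvd_mult_iff dest: prime_dvd_power)
    moreover have "prime (2::int)" "prime (3::int)" "prime (5::int)" by simp_all
    ultimately show "p \<in> P"
      using \<open>prime p\<close> by (metis P_def insertCI primes_dvd_imp_eq)
  qed
  have prime_P: "prime p" if "p \<in> P" for p using that by (auto simp: P_def)
  have finC: "finite C"
    using assms(4,5) by (meson finite_atLeastAtMost finite_imageD finite_imageI finite_subset)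
  have modC: "snd c > 1 \<and> prime_factors (snd c) \<subseteq> P" if "c \<in> C" for c
    using assms(2,5) smooth that by (metis (no_types, opaque_lifting) imageE imageI subsetD)
  have w_less_1: "w {p} < 1" if "p \<in> P" for p
  proof -
    have "w {p} = (\<Sum>d\<in>m ` {i \<in> {1..n}. prime_factors (m i) = {p}}. 1 / real_of_int d)"
      unfolding w_def using assms(1) by (subst sum.reindex) (auto intro: inj_on_subset)
    also have "\<dots> < 1"
    proof (rule sum_prime_powers_less_1)
      show "d > 0 \<and> prime_factors d = {p}"
        if "d \<in> m ` {i \<in> {1..n}. prime_factors (m i) = {p}}" for d
        using that assms(2) by (auto dest: less_trans[OF zero_less_one])
    qed (use prime_P[OF that] in auto)
    finally show ?thesis .
  qed
  \<comment> \<open>The factor \<open>of_bool\<close> removes the powers of a single prime, so that the mixed sum can run over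
    all indices and be grouped by sets of prime factors.\<close>
  define H where "H A = of_bool (card A \<ge> 2) * (\<Prod>p\<in>P - A. 1 - w {p})" for A

  have "(\<Sum>c | c \<in> C \<and> card (prime_factors (snd c)) \<ge> 2.
           1 / real_of_int (snd c) * (\<Prod>p\<in>P - prime_factors (snd c). 1 - w {p}))
      \<le> (\<Sum>i | i \<in> {1..n} \<and> card (prime_factors (m i)) \<ge> 2.
           1 / real_of_int (m i) * (\<Prod>p\<in>P - prime_factors (m i). 1 - w {p}))"
  proof (rule sum_subsystem_le[where Q = "\<lambda>d. card (prime_factors d) \<ge> 2"
        and g = "\<lambda>d. 1 / real_of_int d * (\<Prod>p\<in>P - prime_factors d. 1 - w {p})"])
    show "0 \<le> 1 / real_of_int (m i) * (\<Prod>p\<in>P - prime_factors (m i). 1 - w {p})"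
      if "i \<in> {1..n}" for i
    proof (intro mult_nonneg_nonneg prod_nonneg)
      show "0 \<le> 1 / real_of_int (m i)" using assms(2)[OF that] by simp
      show "0 \<le> 1 - w {p}" if "p \<in> P - prime_factors (m i)" for p
        using w_less_1[of p] that by simp
    qed
  qed (use assms in auto)
  also have "\<dots> = (\<Sum>i\<in>{1..n}. 1 / real_of_int (m i) * H (prime_factors (m i)))"
    by (intro sum.mono_neutral_cong_left) (auto simp: H_def)
  also have "\<dots> = (\<Sum>A\<in>Pow P. w A * H A)"
    unfolding w_def by (rule sum_group_weights) (use smooth in \<open>auto simp: P_def\<close>)
  also have "\<dots> = w {2, 3} * (1 - w {5}) + w {2, 5} * (1 - w {3}) + w {3, 5} * (1 - w {2}) + w {2, 3, 5}"
    unfolding P_def sum_Pow_2_3_5 H_def by (simp add: insert_Diff_if)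
  finally have mixed: "(\<Sum>c | c \<in> C \<and> card (prime_factors (snd c)) \<ge> 2.
           1 / real_of_int (snd c) * (\<Prod>p\<in>P - prime_factors (snd c). 1 - w {p})) \<le> \<dots>" .

  have "(\<Prod>p\<in>P. 1 - w {p})
      - (\<Sum>c | c \<in> C \<and> card (prime_factors (snd c)) \<ge> 2.
           1 / real_of_int (snd c) * (\<Prod>p\<in>P - prime_factors (snd c). 1 - w {p}))
    \<le> 1 - covered_density C"
  proof (rule uncovered_density_ge)
    show "(\<Sum>c | c \<in> C \<and> prime_factors (snd c) = {p}. 1 / real_of_int (snd c)) \<le> w {p}" for p
      unfolding w_def
    proof (rule sum_subsystem_le[where Q = "\<lambda>d. prime_factors d = {p}" and g = "\<lambda>d. 1 / real_of_int d"])
      show "0 \<le> 1 / real_of_int (m i)" if "i \<in> {1..n}" for i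
        using assms(2)[OF that] by simp
    qed (use assms in auto)
  qed (use finC prime_P modC w_less_1 in \<open>auto simp: P_def\<close>)
  moreover have "(\<Prod>p\<in>P. 1 - w {p}) = (1 - w {2}) * (1 - w {3}) * (1 - w {5})"
    by (simp add: P_def mult.assoc)
  moreover have "1 - density_bound n m = (1 - w {2}) * (1 - w {3}) * (1 - w {5})
    - (w {2, 3} * (1 - w {5}) + w {2, 5} * (1 - w {3}) + w {3, 5} * (1 - w {2}) + w {2, 3, 5})"
    using density_bound_eq[of n m] assms(2) smooth by (simp add: w_def P_def)
  ultimately have bound: "covered_density C \<le> density_bound n m"
    using mixed by linarith
  moreover have "\<exists>x. \<forall>(r, d)\<in>C. \<not> [x = r] (mod d)" if "density_bound n m < 1"
  proof (rule ccontr)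
    assume "\<not> (\<exists>x. \<forall>(r, d)\<in>C. \<not> [x = r] (mod d))"
    then have "covered_set C = UNIV" by (auto simp: covered_set_def case_prod_unfold)
    moreover have "snd c > 0" if "c \<in> C" for c using modC[OF that] by simp
    ultimately have "covered_density C = 1"
      using covered_density_eq_dens[OF finC] Lcm_moduli_pos[OF finC] by (simp add: dens_UNIV)
    with bound that show False by simp
  qed
  ultimately show ?thesis by blast
qed

end
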